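(* Let $(\Omega,\mathcal E,P)$ be a probability space, $\mathcal F$ a $\sigma$-subalgebra of $\mathcal E$, and let $f:L^\infty(\mathcal E)\to L^\infty(\mathcal F)$ be an $L^\infty$-conditional risk measure. Then there is a unique $L^\infty_{\mathcal F}(\mathcal E)$-conditional risk measure $\bar f:L^\infty_{\mathcal F}(\mathcal E)\to L^0(\mathcal F)$ such that $|\bar f(x)-\bar f(y)|\le|||x-y|||_\infty$ for all $x,y\in L^\infty_{\mathcal F}(\mathcal E)$ and $\bar f|_{L^\infty(\mathcal E)}=f$.
   Context: $L^0(\mathcal E)$, $L^0(\mathcal F)$ are the algebras of (a.s.-equality) equivalence classes of real $\mathcal E$-, respectively $\mathcal F$-, measurable random variables with the a.s. order; $L^0_+(\mathcal F)=\{\xi\in L^0(\mathcal F):\xi\ge0\}$; $\bar L^0_+(\mathcal F)$ is the set of classes of $[0,\infty]$-valued $\mathcal F$-measurable functions. $L^\infty(\mathcal E)=L^\infty(\Omega,\mathcal E,P)$, $L^\infty(\mathcal F)=L^\infty(\Omega,\mathcal F,P)$ are the usual spaces of essentially bounded real random variables. For $x\in L^0(\mathcal E)$, $|||x|||_\infty=\bigwedge\{\xi\in\bar L^0_+(\mathcal F):|x|\le\xi\}$ (essential infimum), and $L^\infty_{\mathcal F}(\mathcal E)=\{x\in L^0(\mathcal E):|||x|||_\infty\in L^0_+(\mathcal F)\}$. An $L^\infty$-conditional risk measure is a function $f:L^\infty(\mathcal E)\to L^\infty(\mathcal F)$ that is monotone ($f(x)\le f(y)$ whenever $x\ge y$)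 and cash invariant ($f(x+y)=f(x)-y$ for $x\in L^\infty(\mathcal E)$, $y\in L^\infty(\mathcal F)$). A function $\bar f:L^\infty_{\mathcal F}(\mathcal E)\to L^0(\mathcal F)$ is an $L^\infty_{\mathcal F}(\mathcal E)$-conditional risk measure if it is monotone ($\bar f(x)\le\bar f(y)$ whenever $x\ge y$) and cash invariant ($\bar f(x+y)=\bar f(x)-y$ for $x\in L^\infty_{\mathcal F}(\mathcal E)$, $y\in L^0(\mathcal F)$). *)

theory Defs
  imports "HOL-Probability.Probability"
begin

text \<open>
  Random variables modulo a.s. equality are elements of the quotient
  \<^term>\<open>borel_measurable M // ae_eq M\<close>, i.e. sets of measurable functions.
  The measure space \<open>M\<close> carries both the big sigma-algebra and the probability;
  a sub-sigma-algebra is given as a measure \<open>F\<close> with \<^term>\<open>subalgebra M F\<close>, of which only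
  \<^term>\<open>sets F\<close> matters.  As usual, \<open>L\<^sup>0(F)\<close> is identified with a subset of \<open>L\<^sup>0(M)\<close>:
  the classes having an \<open>F\<close>-measurable representative.
\<close>

definition ae_eq :: "'a measure \<Rightarrow> ('a \<Rightarrow> 'b::topological_space) rel" where
  "ae_eq M = {(u, v). u \<in> borel_measurable M \<and> v \<in> borel_measurable M \<and> (AE w in M. u w = v w)}"

lemma equiv_ae_eq: "equiv (borel_measurable M) (ae_eq M)"
  by (rule equivI) (auto simp: ae_eq_def refl_on_def sym_def trans_def)

text \<open>For \<open>'b = real\<close> this is \<open>L\<^sup>0(F)\<close> (and \<open>L0 M M\<close> is \<open>L\<^sup>0(M)\<close>); for \<open>'b = ennreal\<close> it is the
  set of classes of \<open>[0,\<infinity>]\<close>-valued \<open>F\<close>-measurable functions.\<close>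

definition L0 :: "'a measure \<Rightarrow> 'a measure \<Rightarrow> ('a \<Rightarrow> 'b::topological_space) set set" where
  "L0 M F = {x \<in> borel_measurable M // ae_eq M. \<exists>u\<in>x. u \<in> borel_measurable F}"

definition ae_le ::
  "'a measure \<Rightarrow> ('a \<Rightarrow> 'b::ord) set \<Rightarrow> ('a \<Rightarrow> 'b) set \<Rightarrow> bool" where
  "ae_le M x y \<longleftrightarrow> (\<exists>u\<in>x. \<exists>v\<in>y. AE w in M. u w \<le> v w)"

definition L0_map ::
  "'a measure \<Rightarrow> ('b \<Rightarrow> 'c::topological_space) \<Rightarrow> ('a \<Rightarrow> 'b) set \<Rightarrow> ('a \<Rightarrow> 'c) set" where
  "L0_map M h x = (\<Union>u\<in>x. ae_eq M `` {\<lambda>w. h (u w)})"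

definition L0_add ::
  "'a measure \<Rightarrow> ('a \<Rightarrow> real) set \<Rightarrow> ('a \<Rightarrow> real) set \<Rightarrow> ('a \<Rightarrow> real) set" where
  "L0_add M x y = (\<Union>u\<in>x. \<Union>v\<in>y. ae_eq M `` {\<lambda>w. u w + v w})"

definition L0_diff ::
  "'a measure \<Rightarrow> ('a \<Rightarrow> real) set \<Rightarrow> ('a \<Rightarrow> real) set \<Rightarrow> ('a \<Rightarrow> real) set" where
  "L0_diff M x y = (\<Union>u\<in>x. \<Union>v\<in>y. ae_eq M `` {\<lambda>w. u w - v w})"

definition L0_nonneg :: "'a measure \<Rightarrow> 'a measure \<Rightarrow> ('a \<Rightarrow> real) set set" where
  "L0_nonneg M F = {x \<in> L0 M F. ae_le M (ae_eq M `` {\<lambda>_. 0}) x}"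

definition Linf :: "'a measure \<Rightarrow> 'a measure \<Rightarrow> ('a \<Rightarrow> real) set set" where
  "Linf M F = {x \<in> L0 M F. \<exists>u\<in>x. \<exists>C. AE w in M. \<bar>u w\<bar> \<le> C}"

text \<open>The essential infimum: the greatest lower bound in \<open>L0 M F\<close> with values in \<open>[0,\<infinity>]\<close>.\<close>

definition ess_Inf ::
  "'a measure \<Rightarrow> 'a measure \<Rightarrow> ('a \<Rightarrow> ennreal) set set \<Rightarrow> ('a \<Rightarrow> ennreal) set" where
  "ess_Inf M F A = (THE z. z \<in> L0 M F \<and> (\<forall>\<xi>\<in>A. ae_le M z \<xi>) \<and>
      (\<forall>z'\<in>L0 M F. (\<forall>\<xi>\<in>A. ae_le M z' \<xi>) \<longrightarrow> ae_le M z' z))"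

text \<open>The absolute value of a real class, viewed as a \<open>[0,\<infinity>]\<close>-valued class so that it can be
  compared with conditional norms.\<close>

abbreviation L0_abs :: "'a measure \<Rightarrow> ('a \<Rightarrow> real) set \<Rightarrow> ('a \<Rightarrow> ennreal) set" where
  "L0_abs M \<equiv> L0_map M (\<lambda>r. ennreal \<bar>r\<bar>)"

definition cond_norm_inf ::
  "'a measure \<Rightarrow> 'a measure \<Rightarrow> ('a \<Rightarrow> real) set \<Rightarrow> ('a \<Rightarrow> ennreal) set" where
  "cond_norm_inf M F x = ess_Inf M F {\<xi> \<in> L0 M F. ae_le M (L0_abs M x) \<xi>}"

text \<open>Here \<open>L\<^sup>0\<^sub>+(F)\<close> is embedded into the \<open>[0,\<infinity>]\<close>-valued classes by \<^const>\<open>ennreal\<close>.\<close>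

definition cond_Linf :: "'a measure \<Rightarrow> 'a measure \<Rightarrow> ('a \<Rightarrow> real) set set" where
  "cond_Linf M F = {x \<in> L0 M M. cond_norm_inf M F x \<in> L0_map M ennreal ` L0_nonneg M F}"

text \<open>Maps between the spaces are extensional functions (\<open>\<rightarrow>\<^sub>E\<close>), so that HOL equality is
  equality of maps on the given domain.\<close>

definition cond_risk_measure ::
  "'a measure \<Rightarrow> ('a \<Rightarrow> real) set set \<Rightarrow> ('a \<Rightarrow> real) set set \<Rightarrow>
    (('a \<Rightarrow> real) set \<Rightarrow> ('a \<Rightarrow> real) set) \<Rightarrow> bool" where
  "cond_risk_measure M X Y f \<longleftrightarrow>
     f \<in> X \<rightarrow>\<^sub>E Y \<and>
     (\<forall>x\<in>X. \<forall>y\<in>X. ae_le M y x \<longrightarrow> ae_le M (f x) (f y)) \<and>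
     (\<forall>x\<in>X. \<forall>y\<in>Y. f (L0_add M x y) = L0_diff M (f x) y)"

definition Linf_cond_risk_measure ::
  "'a measure \<Rightarrow> 'a measure \<Rightarrow> (('a \<Rightarrow> real) set \<Rightarrow> ('a \<Rightarrow> real) set) \<Rightarrow> bool" where
  "Linf_cond_risk_measure M F = cond_risk_measure M (Linf M M) (Linf M F)"

definition cond_Linf_cond_risk_measure ::
  "'a measure \<Rightarrow> 'a measure \<Rightarrow> (('a \<Rightarrow> real) set \<Rightarrow> ('a \<Rightarrow> real) set) \<Rightarrow> bool" where
  "cond_Linf_cond_risk_measure M F = cond_risk_measure M (cond_Linf M F) (L0 M F)"

end

theory Submission imports Defs begin

text \<open>
  Monotonicity and cash invariance make a conditional risk measure 1-Lipschitz: if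
  \<open>\<bar>x - y\<bar> \<le> b\<close> with \<open>b\<close> measurable for \<open>F\<close>, then \<open>x \<le> y + b\<close> and \<open>y \<le> x + b\<close>.
  If \<open>\<bar>x\<bar> \<le> v\<close> with \<open>v\<close> real-valued and measurable for \<open>F\<close>, and \<open>x\<^sub>n\<close> is \<open>x\<close> clipped to
  \<open>[-n, n]\<close>, then \<open>\<bar>x - x\<^sub>n\<bar> \<le> (v - n)\<^sup>+\<close>, which vanishes for large \<open>n\<close>.  So the values
  \<open>f x\<^sub>n\<close> converge almost surely, any Lipschitz extension of \<open>f\<close> has to send \<open>x\<close> to their limit,
  and the limit inherits monotonicity and cash invariance from \<open>f\<close>.
\<close>

section \<open>Classes and their representatives\<close>

text \<open>For a non-measurable \<open>u\<close> this set is empty rather than a class, so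
  measurability of the representatives is carried along everywhere below.\<close>

abbreviation ae_class :: "'a measure \<Rightarrow> ('a \<Rightarrow> 'b::topological_space) \<Rightarrow> ('a \<Rightarrow> 'b) set" where
  "ae_class M u \<equiv> ae_eq M `` {u}"

lemma mem_ae_eq_iff:
  "(u, v) \<in> ae_eq M \<longleftrightarrow>
    u \<in> borel_measurable M \<and> v \<in> borel_measurable M \<and> (AE w in M. u w = v w)"
  by (auto simp: ae_eq_def)

lemma ae_class_eq_iff:
  assumes "u \<in> borel_measurable M" "v \<in> borel_measurable M"
  shows "ae_class M u = ae_class M v \<longleftrightarrow> (AE w in M. u w = v w)"
  using assms by (auto simp: eq_equiv_class_iff[OF equiv_ae_eq] ae_eq_def)

lemma ae_class_cong:
  assumes "u \<in> borel_measurable M" "v \<in> borel_measurable M" "AE w in M. u w = v w"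
  shows "ae_class M u = ae_class M v"
  using assms by (simp add: ae_class_eq_iff)

lemma ae_le_ae_class_iff:
  fixes u v :: "'a \<Rightarrow> 'b::{topological_space, ord}"
  assumes "u \<in> borel_measurable M" "v \<in> borel_measurable M"
  shows "ae_le M (ae_class M u) (ae_class M v) \<longleftrightarrow> (AE w in M. u w \<le> v w)"
proof
  assume "ae_le M (ae_class M u) (ae_class M v)"
  then obtain u' v' where "u' \<in> ae_class M u" "v' \<in> ae_class M v" "AE w in M. u' w \<le> v' w"
    unfolding ae_le_def by blast
  then have "AE w in M. u w = u' w" "AE w in M. v w = v' w" "AE w in M. u' w \<le> v' w"
    by (simp_all add: mem_ae_eq_iff)
  then show "AE w in M. u w \<le> v w"
    by eventually_elim simp
next
  assume "AE w in M. u w \<le> v w"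
  then show "ae_le M (ae_class M u) (ae_class M v)"
    unfolding ae_le_def using assms by (intro bexI[of _ u] bexI[of _ v]) (auto simp: mem_ae_eq_iff)
qed

lemma L0_map_ae_class:
  assumes "u \<in> borel_measurable M" "h \<in> borel_measurable borel"
  shows "L0_map M h (ae_class M u) = ae_class M (\<lambda>w. h (u w))"
proof -
  have "ae_class M (\<lambda>w. h (v w)) = ae_class M (\<lambda>w. h (u w))" if "v \<in> ae_class M u" for v
  proof (rule ae_class_cong)
    show "AE w in M. h (v w) = h (u w)"
      using that by (auto simp: mem_ae_eq_iff)
  qed (use that assms in \<open>auto simp: mem_ae_eq_iff intro: measurable_compose\<close>)
  moreover have "u \<in> ae_class M u"
    using assms by (simp add: mem_ae_eq_iff)
  ultimately show ?thesis
    unfolding L0_map_def by blast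
qed

lemma L0_add_ae_class:
  assumes "u \<in> borel_measurable M" "v \<in> borel_measurable M"
  shows "L0_add M (ae_class M u) (ae_class M v) = ae_class M (\<lambda>w. u w + v w)"
proof -
  have "ae_class M (\<lambda>w. u' w + v' w) = ae_class M (\<lambda>w. u w + v w)"
    if "u' \<in> ae_class M u" "v' \<in> ae_class M v" for u' v'
  proof (rule ae_class_cong)
    have "AE w in M. u w = u' w" "AE w in M. v w = v' w"
      using that by (auto simp: mem_ae_eq_iff)
    then show "AE w in M. u' w + v' w = u w + v w"
      by eventually_elim simp
  qed (use that assms in \<open>auto simp: mem_ae_eq_iff\<close>)
  moreover have "u \<in> ae_class M u" "v \<in> ae_class M v"
    using assms by (auto simp: mem_ae_eq_iff)
  ultimately show ?thesis
    unfolding L0_add_def by blast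
qed

lemma L0_diff_ae_class:
  assumes "u \<in> borel_measurable M" "v \<in> borel_measurable M"
  shows "L0_diff M (ae_class M u) (ae_class M v) = ae_class M (\<lambda>w. u w - v w)"
proof -
  have "ae_class M (\<lambda>w. u' w - v' w) = ae_class M (\<lambda>w. u w - v w)"
    if "u' \<in> ae_class M u" "v' \<in> ae_class M v" for u' v'
  proof (rule ae_class_cong)
    have "AE w in M. u w = u' w" "AE w in M. v w = v' w"
      using that by (auto simp: mem_ae_eq_iff)
    then show "AE w in M. u' w - v' w = u w - v w"
      by eventually_elim simp
  qed (use that assms in \<open>auto simp: mem_ae_eq_iff\<close>)
  moreover have "u \<in> ae_class M u" "v \<in> ae_class M v"
    using assms by (auto simp: mem_ae_eq_iff)
  ultimately show ?thesis
    unfolding L0_diff_def by blast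
qed

text \<open>The member of the class that is measurable for \<open>F\<close> generates the whole
  class, since classes are determined by any of their members. Read with \<open>F\<close> equal to
  \<open>M\<close>, this also yields representatives of arbitrary random variables.\<close>

lemma L0_cases:
  assumes "x \<in> L0 M F"
  obtains u where "u \<in> borel_measurable F" "u \<in> borel_measurable M" "x = ae_class M u"
proof -
  obtain u where x: "x \<in> borel_measurable M // ae_eq M" and u: "u \<in> x" "u \<in> borel_measurable F"
    using assms by (auto simp: L0_def)
  obtain v where v: "x = ae_class M v"
    using x by (rule quotientE)
  have "u \<in> borel_measurable M"
    using u(1) by (simp add: v mem_ae_eq_iff)
  moreover have "(v, u) \<in> ae_eq M"
    using u(1) by (simp add: v)
  then have "x = ae_class M u"
    unfolding v by (rule equiv_class_eq[OF equiv_ae_eq])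
  ultimately show thesis
    by (rule that[OF u(2)])
qed

lemma ae_class_mem_L0:
  assumes "u \<in> borel_measurable F" "u \<in> borel_measurable M"
  shows "ae_class M u \<in> L0 M F"
  using assms by (auto simp: L0_def mem_ae_eq_iff intro!: quotientI)

lemma ae_class_mem_Linf_iff:
  assumes "u \<in> borel_measurable F" "u \<in> borel_measurable M"
  shows "ae_class M u \<in> Linf M F \<longleftrightarrow> (\<exists>C. AE w in M. \<bar>u w\<bar> \<le> C)"
proof
  assume "ae_class M u \<in> Linf M F"
  then obtain v C where "AE w in M. u w = v w" "AE w in M. \<bar>v w\<bar> \<le> C"
    by (auto simp: Linf_def mem_ae_eq_iff)
  then have "AE w in M. \<bar>u w\<bar> \<le> C"
    by eventually_elim simp
  then show "\<exists>C. AE w in M. \<bar>u w\<bar> \<le> C" ..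
next
  assume "\<exists>C. AE w in M. \<bar>u w\<bar> \<le> C"
  moreover have "u \<in> ae_class M u"
    using assms by (simp add: mem_ae_eq_iff)
  ultimately show "ae_class M u \<in> Linf M F"
    using assms by (auto simp: Linf_def intro: ae_class_mem_L0)
qed

section \<open>Clipping\<close>

definition clip :: "real \<Rightarrow> real \<Rightarrow> real" where
  "clip c t = max (- c) (min c t)"

lemma borel_measurable_clip [measurable]:
  "u \<in> borel_measurable M \<Longrightarrow> (\<lambda>w. clip c (u w)) \<in> borel_measurable M"
  unfolding clip_def by simp

lemma abs_clip_le: "0 \<le> c \<Longrightarrow> \<bar>clip c t\<bar> \<le> c"
  by (auto simp: clip_def)

lemma clip_eq_self: "\<bar>t\<bar> \<le> c \<Longrightarrow> clip c t = t"
  by (auto simp: clip_def)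

lemma clip_mono: "s \<le> t \<Longrightarrow> clip c s \<le> clip c t"
  by (auto simp: clip_def)

text \<open>The bound depends on the majorant and not on \<open>t\<close>: for a majorant measurable
  for \<open>F\<close> the clipping error is controlled by a function measurable for
  \<open>F\<close>, that is, by an admissible cash amount.\<close>

lemma abs_diff_clip_le:
  assumes "0 \<le> c" "\<bar>t\<bar> \<le> v"
  shows "\<bar>t - clip c t\<bar> \<le> max 0 (v - c)"
  using assms by (auto simp: clip_def)

text \<open>Clipping is not additive. The defect is the sum of three clipping errors, one for each
  of \<open>s\<close>, \<open>t\<close> and \<open>s + t\<close>, under a common majorant.\<close>

lemma abs_clip_add_le:
  assumes "0 \<le> c" "\<bar>s\<bar> \<le> v" "\<bar>t\<bar> \<le> v" "\<bar>s + t\<bar> \<le> v"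
  shows "\<bar>clip c (s + t) - (clip c s + clip c t)\<bar> \<le> 3 * max 0 (v - c)"
proof -
  define e where "e = max 0 (v - c)"
  have "\<bar>s + t - clip c (s + t)\<bar> \<le> e" "\<bar>s - clip c s\<bar> \<le> e" "\<bar>t - clip c t\<bar> \<le> e"
    unfolding e_def using assms by (simp_all only: abs_diff_clip_le)
  then show ?thesis
    unfolding e_def[symmetric] by linarith
qed

lemma LIMSEQ_clip: "(\<lambda>n. clip (real n) t) \<longlonglongrightarrow> t"
proof (rule tendsto_eventually)
  show "\<forall>\<^sub>F n in sequentially. clip (real n) t = t"
    using eventually_ge_at_top[of "nat \<lceil>\<bar>t\<bar>\<rceil>"]
    by eventually_elim (auto intro!: clip_eq_self)
qed

lemma LIMSEQ_excess: "(\<lambda>n. max 0 (v - real n)) \<longlonglongrightarrow> 0"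
proof (rule tendsto_eventually)
  show "\<forall>\<^sub>F n in sequentially. max 0 (v - real n) = 0"
    using eventually_ge_at_top[of "nat \<lceil>v\<rceil>"]
    by eventually_elim auto
qed

section \<open>Lipschitz continuity of risk measures\<close>

text \<open>Monotonicity compares the values at \<open>u\<close> and at \<open>v + b\<close>, and
  cash invariance evaluates the latter as \<open>q - b\<close>. The spaces \<open>X\<close> and
  \<open>Y\<close> stay arbitrary so that the estimate serves bounded and conditionally bounded
  variables alike; hence the membership of the shifted variable is a hypothesis.\<close>

lemma cond_risk_measure_le:
  assumes g: "cond_risk_measure M X Y g"
    and [measurable]: "u \<in> borel_measurable M" "v \<in> borel_measurable M" "b \<in> borel_measurable M"
      "p \<in> borel_measurable M" "q \<in> borel_measurable M"
    and mem: "ae_class M u \<in> X" "ae_class M v \<in> X" "ae_class M b \<in> Y"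
      "ae_class M (\<lambda>w. v w + b w) \<in> X"
    and p: "g (ae_class M u) = ae_class M p" and q: "g (ae_class M v) = ae_class M q"
    and le: "AE w in M. u w \<le> v w + b w"
  shows "AE w in M. q w - p w \<le> b w"
proof -
  have "ae_le M (g (ae_class M (\<lambda>w. v w + b w))) (g (ae_class M u))"
    using g mem le by (simp add: cond_risk_measure_def ae_le_ae_class_iff)
  moreover have "g (ae_class M (\<lambda>w. v w + b w)) = ae_class M (\<lambda>w. q w - b w)"
  proof -
    have "g (L0_add M (ae_class M v) (ae_class M b)) = L0_diff M (g (ae_class M v)) (ae_class M b)"
      using g mem by (auto simp: cond_risk_measure_def)
    then show ?thesis
      by (simp add: L0_add_ae_class L0_diff_ae_class q)
  qed
  ultimately have "AE w in M. q w - b w \<le> p w"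
    by (simp add: p ae_le_ae_class_iff)
  then show ?thesis
    by eventually_elim simp
qed

lemma cond_risk_measure_lipschitz:
  assumes g: "cond_risk_measure M X Y g"
    and meas: "u \<in> borel_measurable M" "v \<in> borel_measurable M" "b \<in> borel_measurable M"
      "p \<in> borel_measurable M" "q \<in> borel_measurable M"
    and mem: "ae_class M u \<in> X" "ae_class M v \<in> X" "ae_class M b \<in> Y"
      "ae_class M (\<lambda>w. u w + b w) \<in> X" "ae_class M (\<lambda>w. v w + b w) \<in> X"
    and p: "g (ae_class M u) = ae_class M p" and q: "g (ae_class M v) = ae_class M q"
    and le: "AE w in M. \<bar>u w - v w\<bar> \<le> b w"
  shows "AE w in M. \<bar>p w - q w\<bar> \<le> b w"
proof -
  have "AE w in M. q w - p w \<le> b w"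
    using le by (intro cond_risk_measure_le[OF g meas(1-3) meas(4,5) mem(1-3,5) p q]) auto
  moreover have "AE w in M. p w - q w \<le> b w"
    using le by (intro cond_risk_measure_le[OF g meas(2,1,3) meas(5,4) mem(2,1,3,4) q p]) auto
  ultimately show ?thesis
    by eventually_elim simp
qed

section \<open>The conditional norm\<close>

text \<open>The map \<open>1 / (1 + t)\<close> reverses the order strictly and sends all of
  \<open>[0, \<infinity>]\<close> into \<open>[0, 1]\<close>, which makes extended-valued functions
  comparable through finite integrals.\<close>

lemma inverse_add_1_le_iff:
  fixes a b :: ennreal
  shows "inverse (1 + a) \<le> inverse (1 + b) \<longleftrightarrow> b \<le> a"
proof (cases a; cases b)
  fix r s :: real
  assume ab: "a = ennreal r" "0 \<le> r" "b = ennreal s" "0 \<le> s"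
  then have "inverse (1 + a) = ennreal (inverse (1 + r))" "inverse (1 + b) = ennreal (inverse (1 + s))"
    by (simp_all add: inverse_ennreal flip: ennreal_1 ennreal_plus)
  then show ?thesis
    using ab by (simp add: ennreal_le_iff inverse_le_iff_le)
qed (auto simp: top_unique ennreal_inverse_positive)

locale prob_subalgebra = prob_space M for M :: "'a measure" +
  fixes F :: "'a measure"
  assumes subalg: "subalgebra M F"
begin

lemma borel_measurable_sub: "u \<in> borel_measurable F \<Longrightarrow> u \<in> borel_measurable M"
  using subalg by (rule measurable_from_subalg)

text \<open>The least dominating function is the infimum of a sequence maximizing the integral of
  \<open>1 / (1 + \<xi>)\<close>: this functional is finite and strictly decreasing in \<open>\<xi>\<close> up to null sets.\<close>

lemma ex_least_majorant:
  fixes a :: "'a \<Rightarrow> ennreal"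
  shows "\<exists>z \<in> borel_measurable F. (AE w in M. a w \<le> z w) \<and>
    (\<forall>\<xi> \<in> borel_measurable F. (AE w in M. a w \<le> \<xi> w) \<longrightarrow> (AE w in M. z w \<le> \<xi> w))"
proof -
  define D where "D = {\<xi> \<in> borel_measurable F. AE w in M. a w \<le> \<xi> w}"
  define I where "I \<xi> = (\<integral>\<^sup>+w. inverse (1 + \<xi> w) \<partial>M)" for \<xi> :: "'a \<Rightarrow> ennreal"
  have D_meas: "\<xi> \<in> borel_measurable M" if "\<xi> \<in> D" for \<xi>
    using that by (auto simp: D_def intro: borel_measurable_sub)
  have "(\<lambda>_. \<top>) \<in> D"
    by (auto simp: D_def)
  then have "D \<noteq> {}"
    by blast
  from ennreal_SUP_countable_SUP[OF this, of I]
  obtain s :: "nat \<Rightarrow> ennreal" where s: "range s \<subseteq> I ` D" "(SUP x\<in>D. I x) = (SUP n. s n)"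
    by (elim exE conjE)
  have "\<forall>n. \<exists>\<xi>. \<xi> \<in> D \<and> s n = I \<xi>"
    using s(1) by blast
  then obtain \<xi> where \<xi>: "\<xi> n \<in> D" "s n = I (\<xi> n)" for n :: nat
    by metis
  define z where "z w = (INF n. \<xi> n w)" for w
  have z: "z \<in> D"
  proof -
    have "z \<in> borel_measurable F"
      unfolding z_def using \<xi>(1) by (intro borel_measurable_INF) (auto simp: D_def)
    \<comment> \<open>Domination survives a countable infimum because countably many null sets have
      a null union.\<close>
    moreover have "AE w in M. \<forall>n. a w \<le> \<xi> n w"
      using \<xi>(1) by (auto simp: D_def AE_all_countable)
    then have "AE w in M. a w \<le> z w"
      by eventually_elim (auto simp: z_def intro: INF_greatest)
    ultimately show ?thesis
      by (simp add: D_def)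
  qed
  \<comment> \<open>Since \<open>z\<close> lies below each \<open>\<xi> n\<close> and
    \<open>I\<close> reverses the order, \<open>z\<close> attains the supremum of \<open>I\<close>
    over \<open>D\<close>.\<close>
  have "s n \<le> I z" for n
    unfolding \<xi>(2) I_def
    by (intro nn_integral_mono) (auto simp: inverse_add_1_le_iff z_def intro!: INF_lower)
  then have I_le: "I y \<le> I z" if "y \<in> D" for y
    using that s(2) by (metis SUP_least SUP_upper order.trans)
  have "AE w in M. z w \<le> y w" if y: "y \<in> D" for y
  proof -
    \<comment> \<open>If \<open>z\<close> exceeded \<open>y\<close> on a set of positive measure,
      then \<open>m\<close> would still belong to \<open>D\<close> and have a strictly larger
      integral than the maximal \<open>I z\<close>; strictness relies on \<open>I z\<close> being
      finite.\<close>
    define m where "m = (\<lambda>w. min (z w) (y w))"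
    have m: "m \<in> D"
      using y z by (auto simp: D_def m_def)
    have [measurable]: "y \<in> borel_measurable M" "z \<in> borel_measurable M"
      using y z by (auto intro: D_meas)
    have "inverse (1 + z w) \<le> 1" for w
      using inverse_add_1_le_iff[of "z w" 0] by simp
    then have "I z \<le> (\<integral>\<^sup>+w. 1 \<partial>M)"
      unfolding I_def by (intro nn_integral_mono)
    then have fin: "I z \<noteq> \<infinity>"
      by (auto simp: emeasure_space_1 top_unique)
    have "AE w in M. inverse (1 + m w) \<le> inverse (1 + z w)"
    proof (rule ccontr)
      assume "\<not> ?thesis"
      then have "I z < I m"
        using fin unfolding I_def
        by (intro nn_integral_less) (auto simp: inverse_add_1_le_iff m_def)
      then show False
        using I_le[OF m] by simp
    qed
    then show ?thesis
      by eventually_elim (simp add: inverse_add_1_le_iff m_def)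
  qed
  then show ?thesis
    using z by (auto simp: D_def)
qed

text \<open>The least majorant is itself one of the classes whose infimum is taken, so the infimum
  is attained, and antisymmetry of the order makes the description in \<open>ess_Inf\<close>
  unique.\<close>

lemma cond_norm_inf_ae_class:
  assumes u: "u \<in> borel_measurable M"
  obtains z where "z \<in> borel_measurable F" "cond_norm_inf M F (ae_class M u) = ae_class M z"
    "AE w in M. ennreal \<bar>u w\<bar> \<le> z w"
    "\<forall>\<xi>\<in>borel_measurable F. (AE w in M. ennreal \<bar>u w\<bar> \<le> \<xi> w) \<longrightarrow> (AE w in M. z w \<le> \<xi> w)"
proof -
  obtain z where z: "z \<in> borel_measurable F" "AE w in M. ennreal \<bar>u w\<bar> \<le> z w"
    and least: "\<forall>\<xi>\<in>borel_measurable F. (AE w in M. ennreal \<bar>u w\<bar> \<le> \<xi> w) \<longrightarrow> (AE w in M. z w \<le> \<xi> w)"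
    using ex_least_majorant[of "\<lambda>w. ennreal \<bar>u w\<bar>"] by blast
  note zM = borel_measurable_sub[OF z(1)]
  have au: "L0_abs M (ae_class M u) = ae_class M (\<lambda>w. ennreal \<bar>u w\<bar>)"
    using u by (intro L0_map_ae_class) auto
  have auM: "(\<lambda>w. ennreal \<bar>u w\<bar>) \<in> borel_measurable M"
    using u by measurable
  let ?A = "{\<xi> \<in> L0 M F. ae_le M (L0_abs M (ae_class M u)) \<xi>}"
  have zA: "ae_class M z \<in> ?A"
    using z zM auM by (simp add: au ae_le_ae_class_iff ae_class_mem_L0)
  have lb: "ae_le M (ae_class M z) \<xi>" if "\<xi> \<in> ?A" for \<xi>
  proof -
    from that obtain x where "x \<in> borel_measurable F" "x \<in> borel_measurable M" "\<xi> = ae_class M x"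
      by (auto elim: L0_cases)
    with that zM auM least show ?thesis
      by (simp add: au ae_le_ae_class_iff)
  qed
  have "cond_norm_inf M F (ae_class M u) = ae_class M z"
    unfolding cond_norm_inf_def ess_Inf_def
  proof (rule the_equality, intro conjI ballI impI)
    fix y
    assume y: "y \<in> L0 M F \<and> (\<forall>\<xi>\<in>?A. ae_le M y \<xi>) \<and>
      (\<forall>z'\<in>L0 M F. (\<forall>\<xi>\<in>?A. ae_le M z' \<xi>) \<longrightarrow> ae_le M z' y)"
    obtain x where x: "x \<in> borel_measurable M" "y = ae_class M x"
      using conjunct1[OF y] by (rule L0_cases)
    have "ae_le M y (ae_class M z)"
      using y zA by blast
    moreover have "ae_le M (ae_class M z) y"
      using y zA lb by blast
    ultimately have "AE w in M. x w \<le> z w" "AE w in M. z w \<le> x w"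
      using x zM by (simp_all add: ae_le_ae_class_iff)
    then have "AE w in M. x w = z w"
      by eventually_elim (rule antisym)
    then show "y = ae_class M z"
      unfolding x(2) using x(1) zM by (intro ae_class_cong)
  qed (use zA lb in auto)
  then show thesis
    using that z least by blast
qed

text \<open>Passes from an inequality between classes to one between functions: \<open>b\<close> is
  a majorant of \<open>\<bar>v\<bar>\<close> measurable for \<open>F\<close>, hence lies above the
  least one, which the hypothesis places above \<open>\<bar>u\<bar>\<close>.\<close>

lemma cond_norm_inf_le:
  assumes "u \<in> borel_measurable M" "v \<in> borel_measurable M" "b \<in> borel_measurable F"
    and "ae_le M (L0_abs M (ae_class M u)) (cond_norm_inf M F (ae_class M v))"
    and "AE w in M. \<bar>v w\<bar> \<le> b w"
  shows "AE w in M. \<bar>u w\<bar> \<le> b w"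
proof -
  obtain z where z: "z \<in> borel_measurable F" "cond_norm_inf M F (ae_class M v) = ae_class M z"
    "AE w in M. ennreal \<bar>v w\<bar> \<le> z w"
    "\<forall>\<xi>\<in>borel_measurable F. (AE w in M. ennreal \<bar>v w\<bar> \<le> \<xi> w) \<longrightarrow> (AE w in M. z w \<le> \<xi> w)"
    by (rule cond_norm_inf_ae_class[OF assms(2)])
  have [measurable]: "z \<in> borel_measurable M"
    using z(1) by (rule borel_measurable_sub)
  have "AE w in M. z w \<le> ennreal (b w)"
    using assms(3,5) by (intro z(4)[rule_format]) (auto intro: ennreal_leI)
  moreover have "AE w in M. ennreal \<bar>u w\<bar> \<le> z w"
    using assms(1,4) by (subst (asm) L0_map_ae_class) (auto simp: z(2) ae_le_ae_class_iff)
  ultimately show ?thesis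
    using assms(5)
  proof eventually_elim
    case (elim w)
    then have "ennreal \<bar>u w\<bar> \<le> ennreal (b w)"
      by (meson order.trans)
    \<comment> \<open>Required because \<open>ennreal\<close> sends negative reals to 0.\<close>
    moreover have "0 \<le> b w"
      using elim(3) by linarith
    ultimately show ?case
      by simp
  qed
qed

lemma cond_norm_inf_finite:
  assumes u: "u \<in> borel_measurable M" and v: "v \<in> borel_measurable F"
    and le: "AE w in M. \<bar>u w\<bar> \<le> v w"
  obtains b where "b \<in> borel_measurable F" "\<forall>w. 0 \<le> b w" "AE w in M. \<bar>u w\<bar> \<le> b w"
    "cond_norm_inf M F (ae_class M u) = ae_class M (\<lambda>w. ennreal (b w))"
proof -
  obtain z where z: "z \<in> borel_measurable F" "cond_norm_inf M F (ae_class M u) = ae_class M z"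
    "AE w in M. ennreal \<bar>u w\<bar> \<le> z w"
    "\<forall>\<xi>\<in>borel_measurable F. (AE w in M. ennreal \<bar>u w\<bar> \<le> \<xi> w) \<longrightarrow> (AE w in M. z w \<le> \<xi> w)"
    by (rule cond_norm_inf_ae_class[OF u])
  \<comment> \<open>The convention \<open>enn2real \<top> = 0\<close> keeps \<open>b\<close> real
    and nonnegative everywhere; it alters \<open>z\<close> only on a null set, as \<open>z\<close>
    lies almost surely below the real-valued \<open>v\<close>.\<close>
  define b where "b = (\<lambda>w. enn2real (z w))"
  have b: "b \<in> borel_measurable F" "\<forall>w. 0 \<le> b w"
    using z(1) by (simp_all add: b_def)
  have "AE w in M. z w \<le> ennreal (v w)"
    using v le by (intro z(4)[rule_format]) (auto intro: ennreal_leI)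
  then have zb: "AE w in M. z w = ennreal (b w)"
    by eventually_elim (metis b_def ennreal_enn2real_if ennreal_neq_top top_unique)
  have "AE w in M. \<bar>u w\<bar> \<le> b w"
    using z(3) zb by eventually_elim (use b(2) in simp)
  moreover have "cond_norm_inf M F (ae_class M u) = ae_class M (\<lambda>w. ennreal (b w))"
    unfolding z(2) using b(1) z(1) zb by (intro ae_class_cong borel_measurable_sub) auto
  ultimately show thesis
    by (rule that[OF b])
qed

text \<open>Together with \<open>cond_Linf_cases\<close> this characterizes conditional boundedness
  by a real majorant measurable for \<open>F\<close>, the form in which it is used from here
  on.\<close>

lemma ae_class_mem_cond_LinfI:
  assumes u: "u \<in> borel_measurable M" and v: "v \<in> borel_measurable F"
    and le: "AE w in M. \<bar>u w\<bar> \<le> v w"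
  shows "ae_class M u \<in> cond_Linf M F"
proof -
  obtain b where b: "b \<in> borel_measurable F" "\<forall>w. 0 \<le> b w" "AE w in M. \<bar>u w\<bar> \<le> b w"
    "cond_norm_inf M F (ae_class M u) = ae_class M (\<lambda>w. ennreal (b w))"
    by (rule cond_norm_inf_finite[OF assms])
  note bM = borel_measurable_sub[OF b(1)]
  have "cond_norm_inf M F (ae_class M u) = L0_map M ennreal (ae_class M b)"
    using bM b(4) by (simp add: L0_map_ae_class)
  moreover have "ae_class M b \<in> L0_nonneg M F"
    using b bM by (simp add: L0_nonneg_def ae_class_mem_L0 ae_le_ae_class_iff)
  ultimately show ?thesis
    using u by (auto simp: cond_Linf_def ae_class_mem_L0)
qed

lemma cond_Linf_cases:
  assumes "x \<in> cond_Linf M F"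
  obtains u v where "u \<in> borel_measurable M" "x = ae_class M u" "v \<in> borel_measurable F"
    "AE w in M. \<bar>u w\<bar> \<le> v w"
proof -
  obtain u where u: "u \<in> borel_measurable M" "x = ae_class M u"
    using assms by (auto simp: cond_Linf_def elim: L0_cases)
  obtain z where z: "z \<in> borel_measurable F" "cond_norm_inf M F (ae_class M u) = ae_class M z"
    "AE w in M. ennreal \<bar>u w\<bar> \<le> z w"
    by (rule cond_norm_inf_ae_class[OF u(1)])
  obtain r where r: "r \<in> L0_nonneg M F" "cond_norm_inf M F x = L0_map M ennreal r"
    using assms by (auto simp: cond_Linf_def)
  obtain v where v: "v \<in> borel_measurable F" "v \<in> borel_measurable M" "r = ae_class M v"
    using r(1) by (auto simp: L0_nonneg_def elim: L0_cases)
  have "AE w in M. 0 \<le> v w"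
    using r(1) v by (simp add: L0_nonneg_def ae_le_ae_class_iff)
  moreover have "AE w in M. z w = ennreal (v w)"
    using r(2) z(2) u(2) v(2,3) borel_measurable_sub[OF z(1)]
    by (simp add: L0_map_ae_class ae_class_eq_iff)
  ultimately have "AE w in M. \<bar>u w\<bar> \<le> v w"
    using z(3) by eventually_elim simp
  then show thesis
    using that u v by blast
qed

lemma Linf_subset_cond_Linf: "Linf M M \<subseteq> cond_Linf M F"
proof
  fix x assume "x \<in> Linf M M"
  then obtain u where "u \<in> borel_measurable M" "x = ae_class M u"
    by (auto simp: Linf_def elim: L0_cases)
  moreover obtain C where "AE w in M. \<bar>u w\<bar> \<le> C"
    using calculation \<open>x \<in> Linf M M\<close> by (auto simp: ae_class_mem_Linf_iff)
  ultimately show "x \<in> cond_Linf M F"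
    by (auto intro: ae_class_mem_cond_LinfI[where v = "\<lambda>_. C"])
qed

text \<open>Essential bounds on \<open>u\<close>, \<open>v\<close> and \<open>b\<close> keep the
  shifted variables in the domain of \<open>f\<close>. The bound on \<open>b\<close> is why error
  functions are truncated by \<open>min\<close> before this estimate is applied.\<close>

lemma Linf_risk_measure_lipschitz:
  assumes f: "Linf_cond_risk_measure M F f"
    and u: "u \<in> borel_measurable M" "AE w in M. \<bar>u w\<bar> \<le> C"
    and v: "v \<in> borel_measurable M" "AE w in M. \<bar>v w\<bar> \<le> C'"
    and b: "b \<in> borel_measurable F" "AE w in M. \<bar>b w\<bar> \<le> C''"
    and pq: "p \<in> borel_measurable M" "q \<in> borel_measurable M"
      "f (ae_class M u) = ae_class M p" "f (ae_class M v) = ae_class M q"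
    and le: "AE w in M. \<bar>u w - v w\<bar> \<le> b w"
  shows "AE w in M. \<bar>p w - q w\<bar> \<le> b w"
proof (rule cond_risk_measure_lipschitz[OF f[unfolded Linf_cond_risk_measure_def],
        where u = u and v = v])
  note [measurable] = u(1) v(1) borel_measurable_sub[OF b(1)]
  have "AE w in M. \<bar>u w + b w\<bar> \<le> C + C''" "AE w in M. \<bar>v w + b w\<bar> \<le> C' + C''"
    using u(2) v(2) b(2) by auto
  then show "ae_class M (\<lambda>w. u w + b w) \<in> Linf M M" "ae_class M (\<lambda>w. v w + b w) \<in> Linf M M"
    by (auto simp: ae_class_mem_Linf_iff)
  show "ae_class M u \<in> Linf M M" "ae_class M v \<in> Linf M M" "ae_class M b \<in> Linf M F"
    using u v b by (auto simp: ae_class_mem_Linf_iff borel_measurable_sub)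
qed (use u v b pq le borel_measurable_sub in auto)

end

section \<open>The extension\<close>

text \<open>The limit of the values is taken pointwise, which calls for a fixed representative of
  each class.\<close>

definition sub_rep :: "'a measure \<Rightarrow> 'a measure \<Rightarrow> ('a \<Rightarrow> real) set \<Rightarrow> 'a \<Rightarrow> real" where
  "sub_rep M F x = (SOME u. u \<in> borel_measurable F \<and> x = ae_class M u)"

definition clip_value ::
  "'a measure \<Rightarrow> 'a measure \<Rightarrow> (('a \<Rightarrow> real) set \<Rightarrow> ('a \<Rightarrow> real) set) \<Rightarrow> ('a \<Rightarrow> real) set \<Rightarrow>
    nat \<Rightarrow> 'a \<Rightarrow> real" where
  "clip_value M F f x n = sub_rep M F (f (L0_map M (clip (real n)) x))"

text \<open>Where the sequence diverges, \<open>lim\<close> has an unspecified value; on the domain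
  this concerns only a null set, by \<open>LIMSEQ_clip_value\<close>.\<close>

definition clip_extension ::
  "'a measure \<Rightarrow> 'a measure \<Rightarrow> (('a \<Rightarrow> real) set \<Rightarrow> ('a \<Rightarrow> real) set) \<Rightarrow> ('a \<Rightarrow> real) set \<Rightarrow>
    ('a \<Rightarrow> real) set" where
  "clip_extension M F f =
    (\<lambda>x\<in>cond_Linf M F. ae_class M (\<lambda>w. lim (\<lambda>n. clip_value M F f x n w)))"

lemma sub_rep:
  assumes "x \<in> L0 M F"
  shows "sub_rep M F x \<in> borel_measurable F" "ae_class M (sub_rep M F x) = x"
proof -
  have "\<exists>u. u \<in> borel_measurable F \<and> x = ae_class M u"
    using assms by (auto elim: L0_cases)
  from someI_ex[OF this]
  show "sub_rep M F x \<in> borel_measurable F" "ae_class M (sub_rep M F x) = x"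
    unfolding sub_rep_def by auto
qed

section \<open>Almost sure limits of the values at clipped variables\<close>

locale Linf_risk = prob_subalgebra +
  fixes f
  assumes risk: "Linf_cond_risk_measure M F f"
begin

lemma f_mem: "x \<in> Linf M M \<Longrightarrow> f x \<in> Linf M F"
  using risk by (auto simp: Linf_cond_risk_measure_def cond_risk_measure_def)

lemma clip_mem:
  assumes "u \<in> borel_measurable M"
  shows "ae_class M (\<lambda>w. clip (real n) (u w)) \<in> Linf M M"
  using assms abs_clip_le[of "real n"] by (auto simp: ae_class_mem_Linf_iff intro!: exI[of _ "real n"])

lemma clip_value:
  assumes "u \<in> borel_measurable M"
  shows "clip_value M F f (ae_class M u) n \<in> borel_measurable F"
    "f (ae_class M (\<lambda>w. clip (real n) (u w))) = ae_class M (clip_value M F f (ae_class M u) n)"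
proof -
  have "clip (real n) \<in> borel_measurable borel"
    by measurable
  then have *: "L0_map M (clip (real n)) (ae_class M u) = ae_class M (\<lambda>w. clip (real n) (u w))"
    using assms by (intro L0_map_ae_class)
  have "f (ae_class M (\<lambda>w. clip (real n) (u w))) \<in> L0 M F"
    using f_mem[OF clip_mem[OF assms]] by (simp add: Linf_def)
  from sub_rep[OF this] show
    "clip_value M F f (ae_class M u) n \<in> borel_measurable F"
    "f (ae_class M (\<lambda>w. clip (real n) (u w))) = ae_class M (clip_value M F f (ae_class M u) n)"
    by (auto simp: clip_value_def *)
qed

text \<open>By the Lipschitz estimate the values from index \<open>n\<close> on differ from the
  \<open>n\<close>-th by at most the excess of \<open>v\<close> over \<open>n\<close>. At almost
  every point this excess eventually vanishes, so the sequence becomes constant there.\<close>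

lemma LIMSEQ_clip_value:
  assumes u: "u \<in> borel_measurable M" and v: "v \<in> borel_measurable F"
    and le: "AE w in M. \<bar>u w\<bar> \<le> v w"
  shows "AE w in M. (\<lambda>n. clip_value M F f (ae_class M u) n w) \<longlonglongrightarrow>
    lim (\<lambda>n. clip_value M F f (ae_class M u) n w)"
proof -
  let ?p = "clip_value M F f (ae_class M u)"
  have "AE w in M. \<bar>?p m w - ?p n w\<bar> \<le> max 0 (v w - real n)" if "n \<le> m" for m n
  proof -
    \<comment> \<open>The excess may be unbounded. Two clippings at levels \<open>n \<le> m\<close>
      differ by at most \<open>m - n\<close>, so truncation at \<open>m\<close> preserves the
      bound.\<close>
    define b where "b w = min (real m) (max 0 (v w - real n))" for w
    have "AE w in M. \<bar>?p m w - ?p n w\<bar> \<le> b w"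
    proof (rule Linf_risk_measure_lipschitz[OF risk, where C = "real m" and C' = "real n" and C'' = "real m"
          and u = "\<lambda>w. clip (real m) (u w)" and v = "\<lambda>w. clip (real n) (u w)"])
      show "AE w in M. \<bar>clip (real m) (u w) - clip (real n) (u w)\<bar> \<le> b w"
        using le
      proof eventually_elim
        case (elim w)
        then show ?case
          using that by (auto simp: clip_def b_def)
      qed
    qed (use u v clip_value[OF u] borel_measurable_sub in \<open>auto simp: b_def abs_clip_le\<close>)
    then show ?thesis
      by eventually_elim (simp add: b_def)
  qed
  then have "AE w in M. \<forall>n m. n \<le> m \<longrightarrow> \<bar>?p m w - ?p n w\<bar> \<le> max 0 (v w - real n)"
    by (auto simp: AE_all_countable)
  then show ?thesis
  proof eventually_elim
    case (elim w)
    define N where "N = nat \<lceil>v w\<rceil>"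
    have "?p m w = ?p N w" if "N \<le> m" for m
      using elim[rule_format, OF that] by (simp add: N_def) linarith
    then have "(\<lambda>n. ?p n w) \<longlonglongrightarrow> ?p N w"
      by (intro tendsto_eventually) (unfold eventually_sequentially, blast)
    then show ?case
      by (simp add: limI)
  qed
qed

lemma clip_extension_rep:
  assumes "u \<in> borel_measurable M" "v \<in> borel_measurable F" "AE w in M. \<bar>u w\<bar> \<le> v w"
  obtains L where "L \<in> borel_measurable F" "clip_extension M F f (ae_class M u) = ae_class M L"
    "AE w in M. (\<lambda>n. clip_value M F f (ae_class M u) n w) \<longlonglongrightarrow> L w"
proof
  \<comment> \<open>Measurability for \<open>F\<close> holds on the whole space, including the
    points of divergence.\<close>
  show "(\<lambda>w. lim (\<lambda>n. clip_value M F f (ae_class M u) n w)) \<in> borel_measurable F"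
    using clip_value(1)[OF assms(1)] by (rule borel_measurable_lim_metric)
  show "clip_extension M F f (ae_class M u) =
      ae_class M (\<lambda>w. lim (\<lambda>n. clip_value M F f (ae_class M u) n w))"
    using ae_class_mem_cond_LinfI[OF assms] by (simp add: clip_extension_def)
qed (rule LIMSEQ_clip_value[OF assms])

text \<open>Clipping preserves the order, so monotonicity of \<open>f\<close> applies at each level
  and survives the limit.\<close>

lemma clip_extension_mono:
  assumes "x \<in> cond_Linf M F" "y \<in> cond_Linf M F" "ae_le M y x"
  shows "ae_le M (clip_extension M F f x) (clip_extension M F f y)"
proof -
  obtain u v where u: "u \<in> borel_measurable M" "x = ae_class M u" "v \<in> borel_measurable F"
    "AE w in M. \<bar>u w\<bar> \<le> v w"
    using assms(1) by (rule cond_Linf_cases)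
  obtain u' v' where u': "u' \<in> borel_measurable M" "y = ae_class M u'" "v' \<in> borel_measurable F"
    "AE w in M. \<bar>u' w\<bar> \<le> v' w"
    using assms(2) by (rule cond_Linf_cases)
  obtain L where L: "L \<in> borel_measurable F" "clip_extension M F f x = ae_class M L"
    "AE w in M. (\<lambda>n. clip_value M F f x n w) \<longlonglongrightarrow> L w"
    using clip_extension_rep[OF u(1,3,4)] u(2) by blast
  obtain L' where L': "L' \<in> borel_measurable F" "clip_extension M F f y = ae_class M L'"
    "AE w in M. (\<lambda>n. clip_value M F f y n w) \<longlonglongrightarrow> L' w"
    using clip_extension_rep[OF u'(1,3,4)] u'(2) by blast
  have le: "AE w in M. u' w \<le> u w"
    using assms(3) u u' by (simp add: ae_le_ae_class_iff)
  have "AE w in M. clip_value M F f x n w \<le> clip_value M F f y n w" for n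
  proof -
    have "ae_le M (ae_class M (\<lambda>w. clip (real n) (u' w))) (ae_class M (\<lambda>w. clip (real n) (u w)))"
      using le u(1) u'(1) by (auto simp: ae_le_ae_class_iff intro: clip_mono)
    then have "ae_le M (f (ae_class M (\<lambda>w. clip (real n) (u w)))) (f (ae_class M (\<lambda>w. clip (real n) (u' w))))"
      using risk clip_mem[OF u(1)] clip_mem[OF u'(1)]
      by (auto simp: Linf_cond_risk_measure_def cond_risk_measure_def)
    then show ?thesis
      using clip_value[OF u(1)] clip_value[OF u'(1)] u(2) u'(2)
      by (simp add: ae_le_ae_class_iff borel_measurable_sub)
  qed
  then have "AE w in M. \<forall>n. clip_value M F f x n w \<le> clip_value M F f y n w"
    by (simp add: AE_all_countable)
  then have "AE w in M. L w \<le> L' w"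
    using L(3) L'(3) by eventually_elim (auto intro: LIMSEQ_le)
  then show ?thesis
    using L L' by (simp add: ae_le_ae_class_iff borel_measurable_sub)
qed

text \<open>Cash invariance of \<open>f\<close> is exact for the sum of the clipped summands.
  Replacing this sum by the clipped sum costs at most three excesses, which tend to 0.\<close>

lemma clip_extension_cash_invariant:
  assumes "x \<in> cond_Linf M F" "y \<in> L0 M F"
  shows "clip_extension M F f (L0_add M x y) = L0_diff M (clip_extension M F f x) y"
proof -
  obtain u v where u: "u \<in> borel_measurable M" "x = ae_class M u" "v \<in> borel_measurable F"
    "AE w in M. \<bar>u w\<bar> \<le> v w"
    using assms(1) by (rule cond_Linf_cases)
  obtain c where c: "c \<in> borel_measurable F" "c \<in> borel_measurable M" "y = ae_class M c"
    using assms(2) by (rule L0_cases)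
  define s where "s = (\<lambda>w. u w + c w)"
  \<comment> \<open>A single majorant of \<open>u\<close>, \<open>c\<close> and their sum, as
    \<open>abs_clip_add_le\<close> demands.\<close>
  define V where "V = (\<lambda>w. v w + \<bar>c w\<bar>)"
  have [measurable]: "u \<in> borel_measurable M" "c \<in> borel_measurable M" "s \<in> borel_measurable M"
    using u c by (auto simp: s_def)
  have V: "V \<in> borel_measurable F" "AE w in M. \<bar>s w\<bar> \<le> V w"
    using u c by (auto simp: V_def s_def)
  have s: "L0_add M x y = ae_class M s"
    using u c by (simp add: L0_add_ae_class s_def)
  obtain L where L: "L \<in> borel_measurable F" "clip_extension M F f x = ae_class M L"
    "AE w in M. (\<lambda>n. clip_value M F f x n w) \<longlonglongrightarrow> L w"
    using clip_extension_rep[OF u(1,3,4)] u(2) by blast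
  obtain L' where L': "L' \<in> borel_measurable F" "clip_extension M F f (ae_class M s) = ae_class M L'"
    "AE w in M. (\<lambda>n. clip_value M F f (ae_class M s) n w) \<longlonglongrightarrow> L' w"
    using clip_extension_rep[OF _ V] by auto
  have [measurable]: "clip_value M F f x n \<in> borel_measurable M"
    "clip_value M F f (ae_class M s) n \<in> borel_measurable M" for n
    using clip_value(1) u by (auto intro!: borel_measurable_sub)
  have "AE w in M. \<bar>clip_value M F f (ae_class M s) n w - (clip_value M F f x n w - clip (real n) (c w))\<bar>
      \<le> 3 * max 0 (V w - real n)" for n
  proof -
    \<comment> \<open>Three clipped terms of size at most \<open>n\<close> each make
      \<open>3 * n\<close> a valid truncation level.\<close>
    define b where "b w = min (3 * real n) (3 * max 0 (V w - real n))" for w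
    have "AE w in M. \<bar>clip_value M F f (ae_class M s) n w
        - (clip_value M F f x n w - clip (real n) (c w))\<bar> \<le> b w"
    proof (rule Linf_risk_measure_lipschitz[OF risk, where C = "real n" and C' = "2 * real n"
          and C'' = "3 * real n" and u = "\<lambda>w. clip (real n) (s w)"
          and v = "\<lambda>w. clip (real n) (u w) + clip (real n) (c w)"])
      show "AE w in M. \<bar>clip (real n) (s w) - (clip (real n) (u w) + clip (real n) (c w))\<bar> \<le> b w"
        using u(4) V(2)
      proof eventually_elim
        case (elim w)
        have "\<bar>clip (real n) (s w) - (clip (real n) (u w) + clip (real n) (c w))\<bar>
            \<le> 3 * max 0 (V w - real n)"
          unfolding s_def using elim by (intro abs_clip_add_le) (auto simp: V_def s_def)
        moreover have "\<bar>clip (real n) (s w) - (clip (real n) (u w) + clip (real n) (c w))\<bar> \<le> 3 * real n"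
          using abs_clip_le[of "real n" "s w"] abs_clip_le[of "real n" "u w"]
            abs_clip_le[of "real n" "c w"] by linarith
        ultimately show ?case
          by (simp add: b_def)
      qed
      have "\<bar>clip (real n) (u w) + clip (real n) (c w)\<bar> \<le> 2 * real n" for w
        using abs_clip_le[of "real n" "u w"] abs_clip_le[of "real n" "c w"] by linarith
      then show "AE w in M. \<bar>clip (real n) (u w) + clip (real n) (c w)\<bar> \<le> 2 * real n"
        by simp
      \<comment> \<open>The cash amount \<open>c\<close> may be unbounded, whereas its clipping is
        admissible for \<open>f\<close>.\<close>
      have "ae_class M (\<lambda>w. clip (real n) (c w)) \<in> Linf M F"
        using c abs_clip_le[of "real n"]
        by (auto simp: ae_class_mem_Linf_iff intro!: exI[of _ "real n"])
      then have "f (L0_add M (ae_class M (\<lambda>w. clip (real n) (u w))) (ae_class M (\<lambda>w. clip (real n) (c w)))) =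
          L0_diff M (f (ae_class M (\<lambda>w. clip (real n) (u w)))) (ae_class M (\<lambda>w. clip (real n) (c w)))"
        using risk clip_mem[OF u(1)]
        by (auto simp: Linf_cond_risk_measure_def cond_risk_measure_def)
      then show "f (ae_class M (\<lambda>w. clip (real n) (u w) + clip (real n) (c w))) =
          ae_class M (\<lambda>w. clip_value M F f x n w - clip (real n) (c w))"
        unfolding clip_value(2)[OF u(1), folded u(2)]
        by (simp add: L0_add_ae_class L0_diff_ae_class)
    qed (use V clip_value in \<open>auto simp: b_def abs_clip_le\<close>)
    then show ?thesis
      by eventually_elim (simp add: b_def)
  qed
  then have "AE w in M. \<forall>n. \<bar>clip_value M F f (ae_class M s) n w -
      (clip_value M F f x n w - clip (real n) (c w))\<bar> \<le> 3 * max 0 (V w - real n)"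
    by (simp add: AE_all_countable)
  then have "AE w in M. L' w = L w - c w"
    using L(3) L'(3)
  proof eventually_elim
    case (elim w)
    have "(\<lambda>n. \<bar>clip_value M F f (ae_class M s) n w - (clip_value M F f x n w - clip (real n) (c w))\<bar>)
        \<longlonglongrightarrow> \<bar>L' w - (L w - c w)\<bar>"
      using elim by (intro tendsto_intros LIMSEQ_clip)
    moreover have "(\<lambda>n. 3 * max 0 (V w - real n)) \<longlonglongrightarrow> 3 * 0"
      by (intro tendsto_intros LIMSEQ_excess)
    ultimately have "\<bar>L' w - (L w - c w)\<bar> \<le> 3 * 0"
      by (rule LIMSEQ_le) (use elim(1) in blast)
    then show ?case
      by simp
  qed
  then show ?thesis
    unfolding s L(2) L'(2) unfolding c(3) L0_diff_ae_class[OF borel_measurable_sub[OF L(1)] c(2)]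
    using L(1) L'(1) c(1) by (intro ae_class_cong borel_measurable_sub) auto
qed

lemma cond_risk_measure_clip_extension:
  "cond_Linf_cond_risk_measure M F (clip_extension M F f)"
  unfolding cond_Linf_cond_risk_measure_def cond_risk_measure_def
proof (intro conjI ballI impI)
  show "clip_extension M F f \<in> cond_Linf M F \<rightarrow>\<^sub>E L0 M F"
  proof (intro PiE_I)
    fix x assume "x \<in> cond_Linf M F"
    then obtain u v where u: "u \<in> borel_measurable M" "x = ae_class M u" "v \<in> borel_measurable F"
      "AE w in M. \<bar>u w\<bar> \<le> v w"
      by (rule cond_Linf_cases)
    obtain L where "L \<in> borel_measurable F" "clip_extension M F f x = ae_class M L"
      using clip_extension_rep[OF u(1,3,4)] u(2) by blast
    then show "clip_extension M F f x \<in> L0 M F"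
      by (simp add: ae_class_mem_L0 borel_measurable_sub)
  qed (simp add: clip_extension_def)
qed (rule clip_extension_mono clip_extension_cash_invariant; assumption)+

text \<open>An essentially bounded variable is unchanged by clipping from its bound on, so the
  values are eventually representatives of one class. Outside \<open>Linf M M\<close> both sides are
  \<open>undefined\<close>, by extensionality.\<close>

lemma restrict_clip_extension: "restrict (clip_extension M F f) (Linf M M) = f"
proof
  fix x
  show "restrict (clip_extension M F f) (Linf M M) x = f x"
  proof (cases "x \<in> Linf M M")
    case False
    then show ?thesis
      using risk by (auto simp: Linf_cond_risk_measure_def cond_risk_measure_def)
  next
    case True
    then obtain u where u: "u \<in> borel_measurable M" "x = ae_class M u"
      by (auto simp: Linf_def elim: L0_cases)
    obtain C where C: "AE w in M. \<bar>u w\<bar> \<le> C"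
      using True u by (auto simp: ae_class_mem_Linf_iff)
    obtain L where L: "L \<in> borel_measurable F" "clip_extension M F f x = ae_class M L"
      "AE w in M. (\<lambda>n. clip_value M F f x n w) \<longlonglongrightarrow> L w"
      using clip_extension_rep[OF u(1) _ C] u(2) by auto
    define N where "N = nat \<lceil>C\<rceil>"
    have eq: "f x = ae_class M (clip_value M F f x n)" if "N \<le> n" for n
    proof -
      have Cn: "C \<le> real n"
        using that by (simp add: N_def)
      have "AE w in M. clip (real n) (u w) = u w"
        using C by eventually_elim (use Cn in \<open>auto intro: clip_eq_self\<close>)
      then have "ae_class M (\<lambda>w. clip (real n) (u w)) = x"
        unfolding u(2) using u(1) by (intro ae_class_cong borel_measurable_clip)
      then show ?thesis
        using clip_value(2)[OF u(1), of n] u(2) by simp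
    qed
    have meas: "clip_value M F f x n \<in> borel_measurable M" for n
      using clip_value(1)[OF u(1)] u(2) by (simp add: borel_measurable_sub)
    have "AE w in M. \<forall>n. N \<le> n \<longrightarrow> clip_value M F f x n w = clip_value M F f x N w"
    proof -
      have "AE w in M. clip_value M F f x n w = clip_value M F f x N w" if "N \<le> n" for n
      proof -
        have "ae_class M (clip_value M F f x n) = ae_class M (clip_value M F f x N)"
          using eq[OF that] eq[of N] by simp
        then show ?thesis
          using meas by (simp add: ae_class_eq_iff)
      qed
      then show ?thesis
        by (simp add: AE_all_countable)
    qed
    then have "AE w in M. L w = clip_value M F f x N w"
      using L(3)
    proof eventually_elim
      case (elim w)
      then have "(\<lambda>n. clip_value M F f x n w) \<longlonglongrightarrow> clip_value M F f x N w"
        by (intro tendsto_eventually) (unfold eventually_sequentially, blast)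
      then show ?case
        using elim(2) LIMSEQ_unique by blast
    qed
    then have "ae_class M L = f x"
      unfolding eq[OF order_refl] using borel_measurable_sub[OF L(1)] meas by (intro ae_class_cong)
    then show ?thesis
      using True L(2) by simp
  qed
qed

end

text \<open>Holds for every such risk measure, not only for the extension: the conditional norm of
  \<open>x - y\<close> has a real version \<open>b\<close>, and \<open>b\<close> is itself an
  admissible cash amount in \<open>L0 M F\<close>.\<close>

lemma (in prob_subalgebra) cond_Linf_risk_measure_lipschitz:
  assumes g: "cond_Linf_cond_risk_measure M F g"
    and "x \<in> cond_Linf M F" "y \<in> cond_Linf M F"
  shows "ae_le M (L0_abs M (L0_diff M (g x) (g y))) (cond_norm_inf M F (L0_diff M x y))"
proof -
  obtain u v where u: "u \<in> borel_measurable M" "x = ae_class M u" "v \<in> borel_measurable F"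
    "AE w in M. \<bar>u w\<bar> \<le> v w"
    using assms(2) by (rule cond_Linf_cases)
  obtain u' v' where u': "u' \<in> borel_measurable M" "y = ae_class M u'" "v' \<in> borel_measurable F"
    "AE w in M. \<bar>u' w\<bar> \<le> v' w"
    using assms(3) by (rule cond_Linf_cases)
  have "g x \<in> L0 M F" "g y \<in> L0 M F"
    using assms by (auto simp: cond_Linf_cond_risk_measure_def cond_risk_measure_def)
  then obtain p q where [measurable]: "p \<in> borel_measurable M" "q \<in> borel_measurable M"
    and pq: "g x = ae_class M p" "g y = ae_class M q"
    by (metis L0_cases)
  note [measurable] = u(1) u'(1)
  have diff: "(\<lambda>w. u w - u' w) \<in> borel_measurable M"
    by measurable
  have bound: "(\<lambda>w. v w + v' w) \<in> borel_measurable F"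
    using u(3) u'(3) by simp
  have "AE w in M. \<bar>u w - u' w\<bar> \<le> v w + v' w"
    using u(4) u'(4) by eventually_elim linarith
  then obtain b where bF: "b \<in> borel_measurable F" and "\<forall>w. 0 \<le> b w"
    and le: "AE w in M. \<bar>u w - u' w\<bar> \<le> b w"
    and norm: "cond_norm_inf M F (ae_class M (\<lambda>w. u w - u' w)) = ae_class M (\<lambda>w. ennreal (b w))"
    by (rule cond_norm_inf_finite[OF diff bound])
  note [measurable] = bF borel_measurable_sub[OF bF]
  note le
  moreover have "ae_class M (\<lambda>w. u w + b w) \<in> cond_Linf M F"
    using u by (intro ae_class_mem_cond_LinfI[where v = "\<lambda>w. v w + \<bar>b w\<bar>"]) auto
  moreover have "ae_class M (\<lambda>w. u' w + b w) \<in> cond_Linf M F"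
    using u' by (intro ae_class_mem_cond_LinfI[where v = "\<lambda>w. v' w + \<bar>b w\<bar>"]) auto
  ultimately have "AE w in M. \<bar>p w - q w\<bar> \<le> b w"
    using g assms(2,3) pq u u' bF
    by (intro cond_risk_measure_lipschitz[of M "cond_Linf M F" "L0 M F" g u u' b p q])
      (auto simp: cond_Linf_cond_risk_measure_def ae_class_mem_L0)
  then have "AE w in M. ennreal \<bar>p w - q w\<bar> \<le> ennreal (b w)"
    by eventually_elim (rule ennreal_leI)
  moreover have "L0_abs M (ae_class M (\<lambda>w. p w - q w)) = ae_class M (\<lambda>w. ennreal \<bar>p w - q w\<bar>)"
    by (intro L0_map_ae_class) auto
  ultimately show ?thesis
    using u(2) u'(2) pq norm by (simp add: L0_diff_ae_class ae_le_ae_class_iff)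
qed

text \<open>The clippings of \<open>x\<close> are bounded and approach \<open>x\<close> up to an
  excess tending to 0. Both maps share their values there, so the Lipschitz bounds force the values
  at \<open>x\<close> together.\<close>

lemma (in prob_subalgebra) lipschitz_extension_unique:
  assumes g: "g \<in> cond_Linf M F \<rightarrow>\<^sub>E L0 M F" and h: "h \<in> cond_Linf M F \<rightarrow>\<^sub>E L0 M F"
    and g_lip: "\<forall>x\<in>cond_Linf M F. \<forall>y\<in>cond_Linf M F.
      ae_le M (L0_abs M (L0_diff M (g x) (g y))) (cond_norm_inf M F (L0_diff M x y))"
    and h_lip: "\<forall>x\<in>cond_Linf M F. \<forall>y\<in>cond_Linf M F.
      ae_le M (L0_abs M (L0_diff M (h x) (h y))) (cond_norm_inf M F (L0_diff M x y))"
    and eq: "\<And>x. x \<in> Linf M M \<Longrightarrow> g x = h x"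
  shows "g = h"
proof (rule PiE_ext[OF g h])
  fix x assume x: "x \<in> cond_Linf M F"
  then obtain u v where u: "u \<in> borel_measurable M" "x = ae_class M u" "v \<in> borel_measurable F"
    "AE w in M. \<bar>u w\<bar> \<le> v w"
    by (rule cond_Linf_cases)
  \<comment> \<open>Stated for a generic \<open>k\<close> in order to be applied to \<open>g\<close>
    and to \<open>h\<close>.\<close>
  have close: "AE w in M. \<bar>p w - q w\<bar> \<le> max 0 (v w - real n)"
    if k: "\<forall>x\<in>cond_Linf M F. \<forall>y\<in>cond_Linf M F.
        ae_le M (L0_abs M (L0_diff M (k x) (k y))) (cond_norm_inf M F (L0_diff M x y))"
      and [measurable]: "p \<in> borel_measurable M" "q \<in> borel_measurable M"
      and pq: "k x = ae_class M p" "k (ae_class M (\<lambda>w. clip (real n) (u w))) = ae_class M q"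
    for k p q n
  proof (rule cond_norm_inf_le)
    note [measurable] = u(1)
    show "(\<lambda>w. p w - q w) \<in> borel_measurable M"
      "(\<lambda>w. u w - clip (real n) (u w)) \<in> borel_measurable M"
      by measurable
    show "(\<lambda>w. max 0 (v w - real n)) \<in> borel_measurable F"
      using u(3) by measurable
    have "ae_class M (\<lambda>w. clip (real n) (u w)) \<in> cond_Linf M F"
      by (rule ae_class_mem_cond_LinfI[where v = "\<lambda>_. real n"]) (auto simp: abs_clip_le)
    then have "ae_le M (L0_abs M (L0_diff M (ae_class M p) (ae_class M q)))
        (cond_norm_inf M F (L0_diff M x (ae_class M (\<lambda>w. clip (real n) (u w)))))"
      using k x pq by metis
    then show "ae_le M (L0_abs M (ae_class M (\<lambda>w. p w - q w)))
        (cond_norm_inf M F (ae_class M (\<lambda>w. u w - clip (real n) (u w))))"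
      by (simp add: u(2) L0_diff_ae_class)
    show "AE w in M. \<bar>u w - clip (real n) (u w)\<bar> \<le> max 0 (v w - real n)"
      using u(4) by eventually_elim (auto intro: abs_diff_clip_le)
  qed
  obtain p where p: "p \<in> borel_measurable M" "g x = ae_class M p"
    using PiE_mem[OF g x] by (rule L0_cases)
  obtain p' where p': "p' \<in> borel_measurable M" "h x = ae_class M p'"
    using PiE_mem[OF h x] by (rule L0_cases)
  have "AE w in M. \<bar>p w - p' w\<bar> \<le> 2 * max 0 (v w - real n)" for n
  proof -
    have abs_diff_le: "\<bar>s - s'\<bar> \<le> 2 * e" if "\<bar>s - t\<bar> \<le> e" "\<bar>s' - t\<bar> \<le> e" for s s' t e :: real
      using that by linarith
    let ?y = "ae_class M (\<lambda>w. clip (real n) (u w))"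
    have y: "?y \<in> Linf M M"
      using u(1) by (auto simp: ae_class_mem_Linf_iff intro!: exI[of _ "real n"] abs_clip_le)
    obtain q where q: "q \<in> borel_measurable M" "g ?y = ae_class M q"
      using PiE_mem[OF g subsetD[OF Linf_subset_cond_Linf y]] by (rule L0_cases)
    have "AE w in M. \<bar>p w - q w\<bar> \<le> max 0 (v w - real n)"
      by (rule close[OF g_lip p(1) q(1) p(2) q(2)])
    moreover have "AE w in M. \<bar>p' w - q w\<bar> \<le> max 0 (v w - real n)"
      using eq[OF y] q(2) by (intro close[OF h_lip p'(1) q(1) p'(2)]) simp
    ultimately show ?thesis
      by eventually_elim (rule abs_diff_le)
  qed
  then have "AE w in M. \<forall>n. \<bar>p w - p' w\<bar> \<le> 2 * max 0 (v w - real n)"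
    by (simp add: AE_all_countable)
  then have "AE w in M. p w = p' w"
  proof eventually_elim
    case (elim w)
    have "(\<lambda>n. 2 * max 0 (v w - real n)) \<longlonglongrightarrow> 2 * 0"
      by (intro tendsto_intros LIMSEQ_excess)
    then have "\<bar>p w - p' w\<bar> \<le> 2 * 0"
      by (rule LIMSEQ_le_const) (use elim in blast)
    then show ?case
      by simp
  qed
  then show "g x = h x"
    unfolding p(2) p'(2) by (rule ae_class_cong[OF p(1) p'(1)])
qed

theorem theorem4p21:
  fixes M F :: "'a measure"
    and f :: "('a \<Rightarrow> real) set \<Rightarrow> ('a \<Rightarrow> real) set"
  assumes "prob_space M"
    and "subalgebra M F"
    and "Linf_cond_risk_measure M F f"
  shows "\<exists>!g. cond_Linf_cond_risk_measure M F g \<and>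
           (\<forall>x\<in>cond_Linf M F. \<forall>y\<in>cond_Linf M F.
              ae_le M (L0_abs M (L0_diff M (g x) (g y))) (cond_norm_inf M F (L0_diff M x y))) \<and>
           restrict g (Linf M M) = f"
proof -
  interpret Linf_risk M F f
    using assms
    by (simp add: Linf_risk_def prob_subalgebra_def prob_subalgebra_axioms_def Linf_risk_axioms_def)
  show ?thesis
  proof (rule ex1I[of _ "clip_extension M F f"], safe)
    fix g
    assume g: "cond_Linf_cond_risk_measure M F g"
      "\<forall>x\<in>cond_Linf M F. \<forall>y\<in>cond_Linf M F.
        ae_le M (L0_abs M (L0_diff M (g x) (g y))) (cond_norm_inf M F (L0_diff M x y))"
      "f = restrict g (Linf M M)"
    \<comment> \<open>Here \<open>safe\<close> has replaced \<open>f\<close> by the restriction of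
      \<open>g\<close>.\<close>
    show "g = clip_extension M F (restrict g (Linf M M))"
    proof (rule lipschitz_extension_unique)
      show "g x = clip_extension M F (restrict g (Linf M M)) x" if "x \<in> Linf M M" for x
        using fun_cong[OF restrict_clip_extension, of x] that g(3) by simp
    qed (use g cond_risk_measure_clip_extension cond_Linf_risk_measure_lipschitz in
        \<open>auto simp: cond_Linf_cond_risk_measure_def cond_risk_measure_def\<close>)
  qed (auto intro: cond_risk_measure_clip_extension restrict_clip_extension cond_Linf_risk_measure_lipschitz)
qed

end
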